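(* The countable-substitution dynamical system $(\Sigma,\sigma)$ is topologically weakly mixing; that is, $(\Sigma\times\Sigma,\sigma\times\sigma)$ is topologically ergodic, i.e. it has a point whose orbit $\{(\sigma\times\sigma)^n(u,v): n\in\mathbb Z\}$ is dense in $\Sigma\times\Sigma$.
   Context: For $i\ge 1$ define words $\zeta_i(j)$, $0\le j\le i$, over $\{a,b\}$ by $\zeta_i(i)=b$ and $\zeta_i(0)=a$ for all $i\ge 1$, and $\zeta_i(j)=\zeta_{i-1}(j)\zeta_{i-1}(j-1)$ (concatenation) for $i\ge 2$, $0<j<i$. Let $\mathcal L(\zeta)$ be the set of all subwords (contiguous factors) of all words $\zeta_i(j)$, $i\ge 1$, $0\le j\le i$. $\Sigma$ is the set of all sequences in $\{a,b\}^{\mathbb Z}$ all of whose finite subwords belong to $\mathcal L(\zeta)$, with the product topology, and $\sigma$ is the left shift on $\Sigma$. A topological dynamical system (homeomorphism of a compact metric space) is topologically ergodic if it has a point with a dense orbit. *)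

theory Defs
  imports "HOL-Analysis.Analysis" "HOL-Library.Sublist"
begin

section \<open>Topological dynamics\<close>

definition topological_dynamical_system :: "'a topology \<Rightarrow> ('a \<Rightarrow> 'a) \<Rightarrow> bool" where
  "topological_dynamical_system X T \<longleftrightarrow>
     compact_space X \<and> metrizable_space X \<and> homeomorphic_map X X T"

text \<open>Integer powers of a bijection \<open>T\<close> of \<open>topspace X\<close>; meaningful only at points of \<open>topspace X\<close>.\<close>

definition int_iterate :: "'a topology \<Rightarrow> ('a \<Rightarrow> 'a) \<Rightarrow> int \<Rightarrow> 'a \<Rightarrow> 'a" where
  "int_iterate X T n =
     (if n \<ge> 0 then T ^^ nat n else (inv_into (topspace X) T) ^^ nat (- n))"

definition orbit :: "'a topology \<Rightarrow> ('a \<Rightarrow> 'a) \<Rightarrow> 'a \<Rightarrow> 'a set" where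
  "orbit X T x = range (\<lambda>n. int_iterate X T n x)"

definition topologically_ergodic :: "'a topology \<Rightarrow> ('a \<Rightarrow> 'a) \<Rightarrow> bool" where
  "topologically_ergodic X T \<longleftrightarrow>
     (\<exists>x\<in>topspace X. X closure_of (orbit X T x) = topspace X)"

definition topologically_weakly_mixing :: "'a topology \<Rightarrow> ('a \<Rightarrow> 'a) \<Rightarrow> bool" where
  "topologically_weakly_mixing X T \<longleftrightarrow>
     topologically_ergodic (prod_topology X X) (map_prod T T)"


section \<open>The countable-substitution system\<close>

datatype letter = La | Lb

text \<open>
  \<open>zeta i j\<close> is the word \<open>\<zeta>\<^sub>i(j)\<close>, meaningful for \<open>i \<ge> 1\<close> and \<open>j \<le> i\<close> only; outside this range
  the value is arbitrary.
\<close>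

fun zeta :: "nat \<Rightarrow> nat \<Rightarrow> letter list" where
  "zeta i j =
     (if j = 0 then [La]
      else if i \<le> j then [Lb]
      else zeta (i - 1) j @ zeta (i - 1) (j - 1))"

declare zeta.simps [simp del]

lemma zeta_equations:
  "i \<ge> 1 \<Longrightarrow> zeta i i = [Lb]"
  "i \<ge> 1 \<Longrightarrow> zeta i 0 = [La]"
  "i \<ge> 2 \<Longrightarrow> 0 < j \<Longrightarrow> j < i \<Longrightarrow> zeta i j = zeta (i - 1) j @ zeta (i - 1) (j - 1)"
  by (simp_all add: zeta.simps[of i])

definition zeta_language :: "letter list set" where
  "zeta_language = {w. \<exists>i j. 1 \<le> i \<and> j \<le> i \<and> sublist w (zeta i j)}"

definition Sigma_set :: "(int \<Rightarrow> letter) set" where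
  "Sigma_set = {x. \<forall>k l. map x [k..l] \<in> zeta_language}"

definition Sigma_space :: "(int \<Rightarrow> letter) topology" where
  "Sigma_space =
     subtopology (product_topology (\<lambda>_. discrete_topology UNIV) UNIV) Sigma_set"

definition left_shift :: "(int \<Rightarrow> letter) \<Rightarrow> int \<Rightarrow> letter" where
  "left_shift x = (\<lambda>n. x (n + 1))"


subsection \<open>Well-definedness\<close>

abbreviation full_space :: "(int \<Rightarrow> letter) topology" where
  "full_space \<equiv> product_topology (\<lambda>_. discrete_topology UNIV) UNIV"

lemma topspace_full_space [simp]: "topspace full_space = UNIV"
  by auto

lemma topspace_Sigma_space [simp]: "topspace Sigma_space = Sigma_set"
  by (simp add: Sigma_space_def)

lemma UNIV_letter: "UNIV = {La, Lb}"
  using letter.exhaust by auto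

lemma Sigma_set_closed: "closedin full_space Sigma_set"
proof -
  have coord: "continuous_map full_space (discrete_topology UNIV) (\<lambda>x. x i)" for i :: int
    by (rule continuous_map_product_projection) simp
  have op1: "openin full_space {x. x i = c}" for i c
    using openin_continuous_map_preimage[OF coord[of i], of "{c}"] by simp
  have op: "openin full_space {x. map x ks = w}" for ks :: "int list" and w
  proof (induction ks arbitrary: w)
    case Nil
    have "openin full_space UNIV"
      using openin_topspace[of full_space] by simp
    moreover have "{x :: int \<Rightarrow> letter. map x [] = w} = (if w = [] then UNIV else {})"
      by auto
    ultimately show ?case by simp
  next
    case (Cons k ks)
    show ?case
    proof (cases w)
      case Nil then show ?thesis by simp
    next
      case (Cons c w')
      then have "{x. map x (k # ks) = w} = {x. x k = c} \<inter> {x. map x ks = w'}" by auto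
      then show ?thesis using op1 Cons.IH by (simp add: openin_Int)
    qed
  qed
  have "- Sigma_set = (\<Union>(k, l)\<in>UNIV. \<Union>w\<in>- zeta_language. {x. map x [k..l] = w})"
    by (auto simp: Sigma_set_def)
  then have "openin full_space (- Sigma_set)"
    by (auto intro!: openin_Union op)
  then show ?thesis
    by (simp add: closedin_def Compl_eq_Diff_UNIV)
qed

lemma map_left_shift: "map (left_shift x) [k..l] = map x [k + 1..l + 1]"
  by (rule nth_equalityI) (auto simp: left_shift_def add_ac)

lemma left_shift_in_Sigma_set_iff: "left_shift x \<in> Sigma_set \<longleftrightarrow> x \<in> Sigma_set"
  unfolding Sigma_set_def mem_Collect_eq map_left_shift
  by (metis diff_add_cancel)

lemma homeomorphic_map_left_shift: "homeomorphic_map Sigma_space Sigma_space left_shift"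
proof -
  define r :: "(int \<Rightarrow> letter) \<Rightarrow> int \<Rightarrow> letter" where "r = (\<lambda>x n. x (n - 1))"
  have inv: "left_shift (r x) = x" "r (left_shift x) = x" for x
    by (auto simp: r_def left_shift_def)
  have rS: "r x \<in> Sigma_set \<longleftrightarrow> x \<in> Sigma_set" for x
    using left_shift_in_Sigma_set_iff[of "r x"] by (simp add: inv)
  have c: "continuous_map full_space full_space (\<lambda>x n. x (f n))" for f :: "int \<Rightarrow> int"
    by (auto simp: continuous_map_componentwise_UNIV intro: continuous_map_product_projection)
  have "continuous_map Sigma_space Sigma_space left_shift"
    "continuous_map Sigma_space Sigma_space r"
    using c[of "\<lambda>n. n + 1"] c[of "\<lambda>n. n - 1"] left_shift_in_Sigma_set_iff rS
    unfolding Sigma_space_def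
    by (auto simp: continuous_map_in_subtopology continuous_map_from_subtopology
        left_shift_def[abs_def] r_def)
  then show ?thesis
    by (auto simp: homeomorphic_map_maps homeomorphic_maps_def inv intro!: exI[of _ r])
qed

lemma Sigma_topological_dynamical_system:
  "topological_dynamical_system Sigma_space left_shift"
proof -
  have "finite (UNIV :: letter set)" by (simp add: UNIV_letter)
  then have "compact_space full_space"
    by (simp add: compact_space_product_topology compact_space_discrete_topology)
  then have "compact_space Sigma_space"
    unfolding Sigma_space_def
    using Sigma_set_closed closedin_compact_space compact_space_subtopology by blast
  moreover have "metrizable_space Sigma_space"
    unfolding Sigma_space_def
    by (intro metrizable_space_subtopology)
      (auto simp: metrizable_space_product_topology intro!: countable_subset[OF _ countableI_type])
  ultimately show ?thesis
    by (simp add: topological_dynamical_system_def homeomorphic_map_left_shift)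
qed

lemma int_iterate_left_shift_prod:
  assumes "u \<in> Sigma_set" "v \<in> Sigma_set"
  shows "int_iterate (prod_topology Sigma_space Sigma_space) (map_prod left_shift left_shift) n (u, v)
       = (\<lambda>k. u (k + n), \<lambda>k. v (k + n))"
proof -
  let ?T = "map_prod left_shift left_shift"
  let ?S = "Sigma_set \<times> Sigma_set"
  have inj: "inj left_shift"
  proof (rule injI)
    fix x y assume "left_shift x = left_shift y"
    then have "left_shift x (n - 1) = left_shift y (n - 1)" for n by simp
    then show "x = y" by (auto simp: left_shift_def)
  qed
  have injT: "inj_on ?T ?S"
    using inj by (auto simp: inj_on_def)
  have pos: "(?T ^^ m) (u, v) = (\<lambda>k. u (k + int m), \<lambda>k. v (k + int m))" for m
    by (induction m) (auto simp: left_shift_def algebra_simps)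
  have neg: "((inv_into ?S ?T) ^^ m) (u, v) = (\<lambda>k. u (k - int m), \<lambda>k. v (k - int m))
      \<and> (\<lambda>k. u (k - int m), \<lambda>k. v (k - int m)) \<in> ?S" for m
  proof (induction m)
    case 0 then show ?case using assms by simp
  next
    case (Suc m)
    let ?p = "(\<lambda>k. u (k - int (Suc m)), \<lambda>k. v (k - int (Suc m)))"
    have T: "?T ?p = (\<lambda>k. u (k - int m), \<lambda>k. v (k - int m))"
      by (simp add: left_shift_def)
    have S: "?p \<in> ?S"
      using Suc T left_shift_in_Sigma_set_iff by (metis map_prod_simp mem_Sigma_iff)
    then have "inv_into ?S ?T (\<lambda>k. u (k - int m), \<lambda>k. v (k - int m)) = ?p"
      using inv_into_f_f[OF injT] T by metis
    then show ?case using Suc S by simp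
  qed
  show ?thesis
    using pos[of "nat n"] neg[of "nat (- n)"] by (auto simp: int_iterate_def)
qed

end

(*
  By Baire's theorem it suffices to show that for any w, u, w', u' in the language some number is at
  the same time a distance from an occurrence of w to one of u and from an occurrence of w' to one of
  u'. All four words occur in W_t = zeta_{2t+2}(t+1) for large t, so it is enough that every integer is
  a difference of two return times of W_t.

  Fix U = W_u and let S_t be the set of differences a - b of positions a of U in a very long W_N and b
  of U in W_t. Up to translation S_t grows with t. Its normalised size converges, and
  rho(n) = lim |(S_t + n) - S_t| / |W_N| is a seminorm on the integers which is small on the return
  times of W_t for large t. Since W_t has positive density, rho is totally bounded. The length
  C(n+b, b) of zeta_{n+b}(b) is a return time of W_t for n, b > t, so rho(C(n+b, b)) is small. On the
  other hand C(n+b, b) = 1 + sum_{s=1..b} C(b, s) C(n, s), and total boundedness gives arbitrarily large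
  n for which all rho(C(n, s)), 1 <= s <= b, are as small as desired. Hence rho(1) = 0, so rho = 0: every
  translate of S_t meets S_t for suitable t and N, which expresses every integer as a difference of two
  return times of U.
*)
theory Submission
  imports Defs "HOL-Complex_Analysis.Great_Picard"
begin

section \<open>Occurrences of words\<close>

definition occ :: "'a list \<Rightarrow> 'a list \<Rightarrow> int set" where
  "occ u w = {int (length xs) | xs ys. w = xs @ u @ ys}"

lemma occI: "w = xs @ u @ ys \<Longrightarrow> int (length xs) \<in> occ u w"
  by (auto simp: occ_def)

lemma occ_refl: "0 \<in> occ u u"
  using occI[of u "[]" u "[]"] by simp

lemma occ_trans:
  assumes "p \<in> occ u v" "q \<in> occ v w"
  shows "p + q \<in> occ u w"
proof -
  obtain xs ys where v: "v = xs @ u @ ys" "p = int (length xs)"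
    using assms(1) by (auto simp: occ_def)
  obtain xs' ys' where w: "w = xs' @ v @ ys'" "q = int (length xs')"
    using assms(2) by (auto simp: occ_def)
  have "w = (xs' @ xs) @ u @ (ys @ ys')" using v w by simp
  from occI[OF this] show ?thesis using v w by (simp add: add.commute)
qed

lemma occ_append_left: "p \<in> occ u v \<Longrightarrow> p \<in> occ u (v @ ys)"
  using occ_trans[of p u v 0 "v @ ys"] occI[of "v @ ys" "[]" v ys] by simp

lemma occ_append_right: "p \<in> occ u v \<Longrightarrow> p + int (length xs) \<in> occ u (xs @ v)"
  using occ_trans[of p u v "int (length xs)" "xs @ v"] occI[of "xs @ v" xs v "[]"] by simp

lemma occ_bounds: "p \<in> occ u w \<Longrightarrow> 0 \<le> p \<and> p + int (length u) \<le> int (length w)"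
  by (auto simp: occ_def)

lemma occ_subset_atLeastAtMost: "occ u w \<subseteq> {0..int (length w)}"
  using occ_bounds by fastforce

lemma finite_occ: "finite (occ u w)"
  using occ_subset_atLeastAtMost finite_subset by blast

lemma sublist_iff_occ: "sublist u w \<longleftrightarrow> occ u w \<noteq> {}"
  by (auto simp: occ_def sublist_def)

text \<open>Since \<open>u\<close> is nonempty, an occurrence inside \<open>xs\<close> starts before
  the junction and one inside \<open>ys\<close> at or after it, so none is counted twice.
  Occurrences across the junction are ignored.\<close>

lemma card_occ_append:
  assumes "u \<noteq> []"
  shows "card (occ u xs) + card (occ u ys) \<le> card (occ u (xs @ ys))"
proof -
  let ?R = "(\<lambda>p. p + int (length xs)) ` occ u ys"
  have "p < int (length xs)" if "p \<in> occ u xs" for p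
    using occ_bounds[OF that] assms by (cases u) auto
  moreover have "int (length xs) \<le> p" if "p \<in> ?R" for p
    using that by (auto dest: occ_bounds)
  ultimately have "occ u xs \<inter> ?R = {}" by force
  then have "card (occ u xs \<union> ?R) = card (occ u xs) + card ?R"
    by (intro card_Un_disjoint) (auto simp: finite_occ)
  also have "card ?R = card (occ u ys)"
    by (rule card_image) (simp add: inj_on_def)
  finally have "card (occ u xs) + card (occ u ys) = card (occ u xs \<union> ?R)" by simp
  also have "\<dots> \<le> card (occ u (xs @ ys))"
    by (rule card_mono[OF finite_occ]) (auto intro: occ_append_left occ_append_right)
  finally show ?thesis .
qed

section \<open>The words of the Pascal system\<close>

text \<open>
  With \<open>k\<close> and \<open>l = i - k\<close> as coordinates the substitution becomes the Pascal triangle recursion.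
\<close>

definition pword :: "nat \<Rightarrow> nat \<Rightarrow> letter list" where
  "pword k l = zeta (k + l) k"

lemma pword_0 [simp]: "pword 0 l = [La]"
  by (simp add: pword_def zeta.simps[of l 0])

lemma pword_Suc_0 [simp]: "pword (Suc k) 0 = [Lb]"
  using zeta_equations(1)[of "Suc k"] by (simp add: pword_def)

lemma pword_Suc_Suc: "pword (Suc k) (Suc l) = pword (Suc k) l @ pword k (Suc l)"
  using zeta_equations(3)[of "Suc k + Suc l" "Suc k"] by (simp add: pword_def)

section \<open>Binomial lengths and occurrence counts\<close>

lemma length_pword: "length (pword k l) = (k + l) choose k"
proof (induction k arbitrary: l)
  case (Suc k)
  note IH = Suc.IH
  show ?case
  proof (induction l)
    case (Suc l)
    then show ?case by (simp add: pword_Suc_Suc IH)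
  qed simp
qed simp

lemma pword_neq_Nil [simp]: "pword k l \<noteq> []"
proof -
  have "0 < (k + l) choose k" by simp
  then show ?thesis by (metis length_pword list.size(3) less_irrefl)
qed

lemma pword_Suc_right: "k \<ge> 1 \<Longrightarrow> pword k (Suc l) = pword k l @ pword (k - 1) (Suc l)"
  using pword_Suc_Suc[of "k - 1" l] by simp

lemma pword_Suc_left: "l \<ge> 1 \<Longrightarrow> pword (Suc k) l = pword (Suc k) (l - 1) @ pword k l"
  using pword_Suc_Suc[of k "l - 1"] by simp

text \<open>By \<open>card_occ_append\<close> the counts satisfy Pascal's recursion as an
  inequality, so they dominate the number of lattice paths from \<open>(k, l)\<close> to
  \<open>(k + a, l + b)\<close>. Positivity of \<open>k\<close> and \<open>l\<close> keeps the
  recursion for \<open>pword\<close> valid along the edges \<open>a = 0\<close> and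
  \<open>b = 0\<close>.\<close>

lemma card_occ_pword:
  assumes "k \<ge> 1" "l \<ge> 1"
  shows "(a + b) choose a \<le> card (occ (pword k l) (pword (k + a) (l + b)))"
proof -
  have step: "card (occ u xs) \<le> card (occ u (xs @ ys))"
    "card (occ u ys) \<le> card (occ u (xs @ ys))" if "u = pword k l" for u xs ys
    using card_occ_append[of u xs ys] that by auto
  have base: "1 \<le> card (occ (pword k l) (pword k l))"
    using occ_refl finite_occ by (metis card_0_eq empty_iff less_one not_le)
  show ?thesis
  proof (induction a arbitrary: b)
    case 0
    show ?case
    proof (induction b)
      case (Suc b)
      then show ?case using step(1) assms(1)
        by (simp add: pword_Suc_right) (meson le_trans step(1))
    qed (use base in simp)
  next
    case (Suc a)
    note IH = Suc.IH
    show ?case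
    proof (induction b)
      case 0
      then show ?case using IH[of 0] step(2) assms(2)
        by (simp add: pword_Suc_left) (meson le_trans step(2))
    next
      case (Suc b)
      have "pword (k + Suc a) (l + Suc b) = pword (k + Suc a) (l + b) @ pword (k + a) (l + Suc b)"
        using pword_Suc_Suc by simp
      then show ?case
        using card_occ_append[of "pword k l" "pword (k + Suc a) (l + b)" "pword (k + a) (l + Suc b)"]
          Suc.IH IH[of "Suc b"] by simp
    qed
  qed
qed

lemma occ_pword_nonempty:
  assumes "k \<ge> 1" "l \<ge> 1" "k \<le> k'" "l \<le> l'"
  shows "occ (pword k l) (pword k' l') \<noteq> {}"
proof -
  have "0 < (k' - k + (l' - l)) choose (k' - k)" by simp
  then show ?thesis
    using card_occ_pword[OF assms(1,2), of "k' - k" "l' - l"] assms(3,4) by auto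
qed

text \<open>
  Every word of the language occurs in all but finitely many of the nested words \<open>core t\<close>.
\<close>

definition core :: "nat \<Rightarrow> letter list" where
  "core t = pword (Suc t) (Suc t)"

lemma length_core: "length (core t) = (2 * Suc t) choose (Suc t)"
  by (simp only: core_def length_pword mult_2)

lemma occ_core_nonempty: "s \<le> t \<Longrightarrow> occ (core s) (core t) \<noteq> {}"
  unfolding core_def by (intro occ_pword_nonempty) auto

section \<open>Positive density of \<open>core t\<close> in longer core words\<close>

lemma central_binomial_Suc_le: "(2 * Suc n) choose Suc n \<le> 4 * ((2 * n) choose n)"
proof -
  \<comment> \<open>Pascal's rule twice; at \<open>n = 0\<close> the truncated \<open>n - 1\<close>
    would add a spurious term, hence the \<open>if\<close>.\<close>
  have "(2 * Suc n) choose Suc n = 2 * ((2 * n choose n)) + (2 * n choose (Suc n)) + (if n = 0 then 0 else (2 * n choose (n - 1)))"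
    by (cases n) auto
  moreover have "(2 * n choose Suc n) \<le> (2 * n choose n)" "(2 * n choose (n - 1)) \<le> (2 * n choose n)"
    by (rule binomial_maximum')+
  ultimately show ?thesis by (simp split: if_splits)
qed

lemma central_binomial_add_le: "(2 * (n + t)) choose (n + t) \<le> 4 ^ t * ((2 * n) choose n)"
proof (induction t)
  case (Suc t)
  then show ?case using central_binomial_Suc_le[of "n + t"] by simp
qed simp

text \<open>The length of \<open>core N\<close> is the central binomial coefficient of index
  \<open>N + 1\<close>, the number of occurrences at least that of index \<open>N - t\<close>. Each
  of the \<open>t + 1\<close> steps in between costs a factor of at most 4.\<close>

lemma density_core:
  assumes "t \<le> N"
  shows "length (core N) \<le> 4 ^ Suc t * card (occ (core t) (core N))"
proof -
  have "length (core N) \<le> 4 ^ Suc t * ((2 * (N - t)) choose (N - t))"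
    using central_binomial_add_le[of "N - t" "Suc t"] assms by (simp add: length_core)
  also have "(2 * (N - t)) choose (N - t) \<le> card (occ (core t) (core N))"
    using card_occ_pword[of "Suc t" "Suc t" "N - t" "N - t"] assms
    by (simp add: core_def mult_2)
  finally show ?thesis by simp
qed

lemma length_core_ge: "N \<le> length (core N)"
proof -
  have "2 * Suc N choose 1 \<le> (2 * Suc N choose Suc N)" by (rule binomial_maximum')
  then show ?thesis by (simp add: length_core)
qed

lemma length_core_at_top: "filterlim (\<lambda>N. length (core N)) at_top sequentially"
  by (rule filterlim_at_top_mono[OF filterlim_ident]) (simp add: length_core_ge)

text \<open>\<open>pword (Suc k) (Suc l)\<close> contains the square of \<open>pword k l\<close>:
  its left factor ends and its right factor begins with that word. An occurrence of
  \<open>core t\<close> in \<open>pword k l\<close> is thus repeated at distance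
  \<open>length (pword k l)\<close>.\<close>

lemma binomial_return:
  assumes "k > t" "l > t"
  obtains s p where "p \<in> occ (core t) (core s)" "p + int ((k + l) choose k) \<in> occ (core t) (core s)"
proof -
  obtain p where p: "p \<in> occ (core t) (pword k l)"
    using occ_pword_nonempty[of "Suc t" "Suc t" k l] assms by (auto simp: core_def)
  let ?X = "pword (Suc k) (Suc l)"
  obtain l' where l': "l = Suc l'" using assms by (cases l) auto
  obtain k' where k': "k = Suc k'" using assms by (cases k) auto
  have "pword (Suc k) (Suc l) = pword (Suc k) l' @ pword k l @ pword k l @ pword (k - 1) (Suc l)"
    by (simp add: k' l' pword_Suc_Suc)
  then have "?X = pword (Suc k) l' @ pword k l @ (pword k l @ pword (k - 1) (Suc l))"
    and "?X = (pword (Suc k) l' @ pword k l) @ pword k l @ pword (k - 1) (Suc l)"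
    by simp_all
  note o = this[THEN occI]
  obtain r where r: "r \<in> occ ?X (core (max k l))"
    using occ_pword_nonempty[of "Suc k" "Suc l" "Suc (max k l)" "Suc (max k l)"]
    by (auto simp: core_def)
  have "p + int (length (pword (Suc k) l')) + r \<in> occ (core t) (core (max k l))"
    "p + int (length (pword (Suc k) l' @ pword k l)) + r \<in> occ (core t) (core (max k l))"
    using occ_trans[OF occ_trans[OF p o(1)] r] occ_trans[OF occ_trans[OF p o(2)] r] by auto
  then show ?thesis
    by (intro that[of "p + int (length (pword (Suc k) l')) + r" "max k l"])
      (simp_all add: length_pword algebra_simps)
qed

lemma mem_zeta_language_iff: "w \<in> zeta_language \<longleftrightarrow> (\<exists>t. sublist w (core t))"
proof
  assume "w \<in> zeta_language"
  then obtain i j where ij: "1 \<le> i" "j \<le> i" "sublist w (zeta i j)"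
    by (auto simp: zeta_language_def)
  have z: "zeta i j = pword j (i - j)" using ij by (simp add: pword_def)
  \<comment> \<open>Raising both coordinates by one makes them positive. The one-letter words on the
    boundary of the triangle, outside the scope of \<open>occ_pword_nonempty\<close>, are located by
    hand.\<close>
  have "sublist (pword j (i - j)) (pword (Suc j) (Suc (i - j)))"
  proof (cases "j = 0 \<or> i - j = 0")
    case True
    have "sublist [La] (pword 1 (Suc l))" "sublist [Lb] (pword (Suc l) 1)" for l
      using pword_Suc_Suc[of 0 l] pword_Suc_Suc[of l 0] by (simp_all add: sublist_appendI)
    show ?thesis
    proof (cases "j = 0")
      case True
      then show ?thesis using \<open>sublist [La] (pword 1 (Suc (i - j)))\<close> by simp
    next
      case False
      then have "i - j = 0" "j = Suc (j - 1)" using True by auto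
      then show ?thesis using \<open>sublist [Lb] (pword (Suc j) 1)\<close>
        by (metis One_nat_def pword_Suc_0)
    qed
  next
    case False
    then have "j \<ge> 1" "i - j \<ge> 1" by auto
    from occ_pword_nonempty[OF this, of "Suc j" "Suc (i - j)"] show ?thesis
      by (simp add: sublist_iff_occ)
  qed
  moreover have "sublist (pword (Suc j) (Suc (i - j))) (core i)"
    using ij by (simp add: sublist_iff_occ core_def occ_pword_nonempty)
  ultimately show "\<exists>t. sublist w (core t)"
    using ij z by (metis sublist_order.order_trans)
next
  assume "\<exists>t. sublist w (core t)"
  then obtain t where "sublist w (zeta (Suc t + Suc t) (Suc t))"
    unfolding core_def pword_def by blast
  moreover have "1 \<le> Suc t + Suc t" "Suc t \<le> Suc t + Suc t" by simp_all
  ultimately show "w \<in> zeta_language"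
    unfolding zeta_language_def by blast
qed

section \<open>Totally bounded seminorms on the integers\<close>

text \<open>A seminorm in the sense of abelian groups: \<open>\<rho> (m - n)\<close> is a
  translation-invariant pseudometric, and multiples are only bounded from above, by
  \<open>scale_le\<close>.\<close>

locale int_seminorm =
  fixes \<rho> :: "int \<Rightarrow> real"
  assumes zero: "\<rho> 0 = 0"
    and minus: "\<rho> (- n) = \<rho> n"
    and triangle: "\<rho> (m + n) \<le> \<rho> m + \<rho> n"
begin

lemma nonneg: "0 \<le> \<rho> n"
  using triangle[of n "- n"] by (simp add: zero minus)

lemma triangle_diff: "\<rho> (m - n) \<le> \<rho> m + \<rho> n"
  using triangle[of m "- n"] by (simp add: minus)

lemma scale_le: "\<rho> (int k * n) \<le> real k * \<rho> n"
proof (induction k)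
  case (Suc k)
  have "\<rho> (int (Suc k) * n) \<le> \<rho> n + \<rho> (int k * n)"
    using triangle[of n "int k * n"] by (simp add: algebra_simps)
  then show ?case using Suc by (simp add: algebra_simps)
qed (simp add: zero)

lemma sum_le: "finite A \<Longrightarrow> \<rho> (\<Sum>x\<in>A. f x) \<le> (\<Sum>x\<in>A. \<rho> (f x))"
proof (induction A rule: finite_induct)
  case (insert x A)
  then show ?case using triangle[of "f x" "sum f A"] by simp
qed (simp add: zero)

text \<open>Vandermonde's sum for \<open>a + n choose t\<close> loses its two end terms, and each
  middle term is a multiple of some \<open>n choose v\<close> with \<open>0 < v < t\<close>. The
  multipliers depend on \<open>a\<close> and \<open>t\<close> alone, so \<open>e\<close> can be
  fitted to \<open>a\<close> before \<open>n\<close> is chosen.\<close>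

lemma choose_add_le:
  assumes "t \<ge> 1" and e: "\<And>v. v \<in> {1..<t} \<Longrightarrow> \<rho> (int (n choose v)) \<le> e"
  shows "\<rho> (int (a + n choose t) - int (a choose t) - int (n choose t))
    \<le> (\<Sum>u\<in>{1..<t}. real (a choose u)) * e"
proof -
  let ?f = "\<lambda>u. int (a choose u) * int (n choose (t - u))"
  have split: "{..t} = insert 0 (insert t {1..<t})" using assms(1) by auto
  have "int (a + n choose t) = (\<Sum>u\<le>t. ?f u)"
    by (simp add: vandermonde[symmetric] flip: of_nat_mult of_nat_sum)
  also have "\<dots> = int (n choose t) + (int (a choose t) + (\<Sum>u\<in>{1..<t}. ?f u))"
    unfolding split using assms(1) by (subst sum.insert; simp)+
  finally have "int (a + n choose t) - int (a choose t) - int (n choose t) = (\<Sum>u\<in>{1..<t}. ?f u)"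
    by simp
  then have "\<rho> (int (a + n choose t) - int (a choose t) - int (n choose t))
      \<le> (\<Sum>u\<in>{1..<t}. \<rho> (?f u))"
    using sum_le[of "{1..<t}" ?f] by simp
  also have "\<dots> \<le> (\<Sum>u\<in>{1..<t}. real (a choose u) * e)"
  proof (rule sum_mono)
    fix u assume u: "u \<in> {1..<t}"
    have "\<rho> (?f u) \<le> real (a choose u) * \<rho> (int (n choose (t - u)))" by (rule scale_le)
    also have "\<dots> \<le> real (a choose u) * e"
      using e[of "t - u"] u by (intro mult_left_mono) auto
    finally show "\<rho> (?f u) \<le> real (a choose u) * e" .
  qed
  finally show ?thesis by (simp add: sum_distrib_right)
qed

end

text \<open>Total boundedness in pigeonhole form, with \<open>q\<close> uniform over all sequences
  \<open>y\<close>.\<close>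

locale totally_bounded_int_seminorm = int_seminorm +
  assumes totally_bounded:
    "e > 0 \<Longrightarrow> \<exists>q. \<forall>y :: nat \<Rightarrow> int. \<exists>r r'. r < r' \<and> r' \<le> q \<and> \<rho> (y r' - y r) \<le> e"
begin

text \<open>
  Induction on \<open>s\<close>: choose \<open>N 0 < N 1 < \<dots>\<close> such that the lower binomials of \<open>N r' - N r\<close> are small
  compared with the binomials of \<open>N r\<close>. By total boundedness two of the numbers \<open>N r choose Suc s\<close>
  are close, and by Vandermonde their difference is nearly \<open>(N r' - N r) choose Suc s\<close>.
\<close>

lemma binomial_recurrence:
  "e > 0 \<Longrightarrow> \<exists>n\<ge>m. \<forall>t\<in>{1..s}. \<rho> (int (n choose t)) < e"
proof (induction s arbitrary: e m)
  case 0
  then show ?case by auto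
next
  case (Suc s)
  note IH = Suc.IH
  \<comment> \<open>If the lower binomials are below \<open>\<eta> M\<close>, the Vandermonde error
    with \<open>a = M\<close> stays below \<open>e / 2\<close>; the summand 1 also forces
    \<open>\<eta> M \<le> e / 2\<close>.\<close>
  define \<eta> where "\<eta> M = e / (2 * (1 + (\<Sum>u\<in>{1..<Suc s}. real (M choose u))))" for M
  have den: "1 + (\<Sum>u\<in>{1..<Suc s}. real (M choose u)) \<ge> 1" for M
    by (simp add: sum_nonneg)
  have \<eta>: "\<eta> M > 0" "\<eta> M \<le> e / 2" "(\<Sum>u\<in>{1..<Suc s}. real (M choose u)) * \<eta> M < e / 2" for M
  proof -
    let ?A = "\<Sum>u\<in>{1..<Suc s}. real (M choose u)"
    have A: "?A \<ge> 0" by (simp add: sum_nonneg)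
    show "\<eta> M > 0" "\<eta> M \<le> e / 2" "?A * \<eta> M < e / 2"
      using A \<open>e > 0\<close> unfolding \<eta>_def by (auto simp: field_simps)
  qed
  \<comment> \<open>Induction step: \<open>N (Suc q) = N q + n\<close>, where the lower binomials of
    \<open>n\<close> are so small that the strict inequalities for the pairs \<open>(r, q)\<close>
    pass to \<open>(r, Suc q)\<close>.\<close>
  have ex: "\<exists>N :: nat \<Rightarrow> nat. \<forall>r r'. r < r' \<and> r' \<le> q \<longrightarrow>
      N r + m \<le> N r' \<and> (\<forall>t\<in>{1..s}. \<rho> (int ((N r' - N r) choose t)) < \<eta> (N r))" for q
  proof (induction q)
    case 0
    show ?case by auto
  next
    case (Suc q)
    then obtain N :: "nat \<Rightarrow> nat" where
      N: "\<And>r r'. r < r' \<Longrightarrow> r' \<le> q \<Longrightarrow> N r + m \<le> N r'"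
        "\<And>r r' t. r < r' \<Longrightarrow> r' \<le> q \<Longrightarrow> t \<in> {1..s} \<Longrightarrow> \<rho> (int ((N r' - N r) choose t)) < \<eta> (N r)"
      by metis
    let ?K = "\<lambda>r t. \<Sum>u\<in>{1..<t}. real ((N q - N r) choose u)"
    have lt: "\<rho> (int ((N q - N r) choose t)) < \<eta> (N r)" if "r \<le> q" "t \<in> {1..s}" for r t
      using N(2)[of r q t] that \<eta>(1)[of "N r"] by (cases "r = q") (auto simp: zero binomial_eq_0)
    \<comment> \<open>Finitely many strict inequalities leave a common slack:
      \<open>?K r t * d\<close> will absorb the Vandermonde error and \<open>d\<close> the term
      \<open>n choose t\<close>.\<close>
    have "\<forall>\<^sub>F d in at_right 0. \<forall>r\<in>{..q}. \<forall>t\<in>{1..s}.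
        \<rho> (int ((N q - N r) choose t)) + ?K r t * d + d < \<eta> (N r)"
    proof (intro eventually_ball_finite ballI)
      fix r t assume "r \<in> {..q}" "t \<in> {1..s}"
      have "((\<lambda>d. \<rho> (int ((N q - N r) choose t)) + ?K r t * d + d) \<longlongrightarrow>
          \<rho> (int ((N q - N r) choose t)) + ?K r t * 0 + 0) (at_right 0)"
        by (intro tendsto_intros)
      then show "\<forall>\<^sub>F d in at_right 0. \<rho> (int ((N q - N r) choose t)) + ?K r t * d + d < \<eta> (N r)"
        using lt[of r t] \<open>r \<in> {..q}\<close> \<open>t \<in> {1..s}\<close> by (intro order_tendstoD(2)) auto
    qed auto
    then have "\<forall>\<^sub>F d in at_right 0. d > 0 \<and> (\<forall>r\<in>{..q}. \<forall>t\<in>{1..s}.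
        \<rho> (int ((N q - N r) choose t)) + ?K r t * d + d < \<eta> (N r))"
      using eventually_at_right_less[of "0::real"] by eventually_elim auto
    then obtain d where d: "d > 0" "\<And>r t. r \<le> q \<Longrightarrow> t \<in> {1..s} \<Longrightarrow>
        \<rho> (int ((N q - N r) choose t)) + ?K r t * d + d < \<eta> (N r)"
      using eventually_happens'[OF trivial_limit_at_right_real] unfolding Ball_def atMost_iff by blast
    obtain n where n: "n \<ge> m" "\<And>t. t \<in> {1..s} \<Longrightarrow> \<rho> (int (n choose t)) < d"
      using IH[OF d(1), of m] by blast
    let ?N = "N(Suc q := N q + n)"
    have le: "N r \<le> N q" if "r \<le> q" for r
      using N(1)[of r q] that by (cases "r = q") auto
    have "?N r + m \<le> ?N (Suc q)" "t \<in> {1..s} \<Longrightarrow> \<rho> (int ((?N (Suc q) - ?N r) choose t)) < \<eta> (?N r)"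
      if "r \<le> q" for r t
    proof -
      show "?N r + m \<le> ?N (Suc q)" using le[OF that] n(1) that by simp
      assume t: "t \<in> {1..s}"
      let ?a = "N q - N r"
      have eq: "?N (Suc q) - ?N r = ?a + n" using le[OF that] that by simp
      have "\<rho> (int (?a + n choose t)) \<le>
        \<rho> (int (?a + n choose t) - int (?a choose t) - int (n choose t)) + (\<rho> (int (?a choose t)) + \<rho> (int (n choose t)))"
        using triangle[of "int (?a + n choose t) - int (?a choose t) - int (n choose t)"
            "int (?a choose t) + int (n choose t)"] triangle[of "int (?a choose t)" "int (n choose t)"]
        by simp
      also have "\<dots> \<le> ?K r t * d + (\<rho> (int (?a choose t)) + d)"
      proof (intro add_mono order_refl)
        show "\<rho> (int (?a + n choose t) - int (?a choose t) - int (n choose t)) \<le> ?K r t * d"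
          using t n(2) by (intro choose_add_le) (auto intro: less_imp_le)
      qed (use n(2)[OF t] in simp)
      also have "\<dots> < \<eta> (N r)" using d(2)[OF that t] by simp
      finally show "\<rho> (int ((?N (Suc q) - ?N r) choose t)) < \<eta> (?N r)"
        using eq that by simp
    qed
    moreover have "?N r + m \<le> ?N r' \<and> (\<forall>t\<in>{1..s}. \<rho> (int ((?N r' - ?N r) choose t)) < \<eta> (?N r))"
      if "r < r'" "r' \<le> q" for r r'
      using N that by simp
    ultimately show ?case
      by (intro exI[of _ ?N] allI impI) (metis le_Suc_eq less_Suc_eq_le)
  qed
  obtain q where q: "\<And>y :: nat \<Rightarrow> int. \<exists>r r'. r < r' \<and> r' \<le> q \<and> \<rho> (y r' - y r) \<le> e / 2"
    using totally_bounded[of "e / 2"] Suc.prems by auto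
  obtain N :: "nat \<Rightarrow> nat" where
    N: "\<And>r r'. r < r' \<Longrightarrow> r' \<le> q \<Longrightarrow> N r + m \<le> N r'"
      "\<And>r r' t. r < r' \<Longrightarrow> r' \<le> q \<Longrightarrow> t \<in> {1..s} \<Longrightarrow> \<rho> (int ((N r' - N r) choose t)) < \<eta> (N r)"
    using ex[of q] by metis
  obtain r r' where r: "r < r'" "r' \<le> q" "\<rho> (int (N r' choose Suc s) - int (N r choose Suc s)) \<le> e / 2"
    using q[of "\<lambda>r. int (N r choose Suc s)"] by auto
  let ?n = "N r' - N r"
  have sum: "N r' = N r + ?n" and m: "?n \<ge> m" using N(1)[OF r(1,2)] by auto
  have small: "\<rho> (int (?n choose t)) < \<eta> (N r)" if "t \<in> {1..s}" for t
    using N(2)[OF r(1,2) that] .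
  let ?x = "int (N r + ?n choose Suc s) - int (N r choose Suc s)"
  have "\<rho> (int (?n choose Suc s)) \<le> \<rho> ?x + \<rho> (?x - int (?n choose Suc s))"
    using triangle_diff[of ?x "?x - int (?n choose Suc s)"] by simp
  also have "\<rho> ?x \<le> e / 2" using r(3) sum by simp
  also have "\<rho> (?x - int (?n choose Suc s)) \<le> (\<Sum>u\<in>{1..<Suc s}. real (N r choose u)) * \<eta> (N r)"
    using small by (intro choose_add_le) (auto intro: less_imp_le)
  also have "\<dots> < e / 2" by (rule \<eta>)
  finally have "\<rho> (int (?n choose Suc s)) < e" by simp
  moreover have "\<rho> (int (?n choose t)) < e" if "t \<in> {1..s}" for t
    using small[OF that] \<eta>(2)[of "N r"] Suc.prems by linarith
  ultimately show ?case using m by (metis atLeastAtMost_iff le_Suc_eq)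
qed

text \<open>
  Vandermonde gives \<open>(b + n) choose b = 1 + \<dots>\<close>, where by recurrence \<open>n\<close> can be chosen such that all
  the other terms are small.
\<close>

lemma seminorm_trivial:
  assumes small: "\<And>e. e > 0 \<Longrightarrow> \<exists>b\<ge>1. \<forall>n\<ge>b. \<rho> (int ((b + n) choose b)) \<le> e"
  shows "\<rho> c = 0"
proof -
  have "\<rho> 1 \<le> 0 + e" if e: "e > 0" for e
  proof -
    obtain b where b: "b \<ge> 1" "\<And>n. n \<ge> b \<Longrightarrow> \<rho> (int ((b + n) choose b)) \<le> e / 2"
      using small[OF half_gt_zero[OF e]] by blast
    define K where "K = (\<Sum>u\<in>{1..<b}. real (b choose u))"
    have "K \<ge> 0" by (simp add: K_def sum_nonneg)
    define d where "d = e / 2 / (K + 1)"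
    have "d > 0" using e \<open>K \<ge> 0\<close> by (simp add: d_def)
    have "K * d + d = (K + 1) * d" by (simp add: algebra_simps)
    also have "\<dots> = e / 2"
      unfolding d_def using \<open>K \<ge> 0\<close> by (metis add_nonneg_pos less_irrefl
        nonzero_mult_div_cancel_left times_divide_eq_right zero_less_one)
    finally have "K * d + d = e / 2" .
    obtain n where n: "n \<ge> b" "\<And>t. t \<in> {1..b} \<Longrightarrow> \<rho> (int (n choose t)) < d"
      using binomial_recurrence[OF \<open>d > 0\<close>, of b b] by auto
    let ?x = "int (b + n choose b)" and ?y = "int (n choose b)"
    \<comment> \<open>Here \<open>1 = (?x - ?y) - (?x - 1 - ?y)\<close>, and the 1 in the last
      bracket stands for \<open>b choose b\<close>.\<close>
    have "\<rho> 1 \<le> \<rho> (?x - ?y) + \<rho> (?x - 1 - ?y)"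
      using triangle_diff[of "?x - ?y" "?x - 1 - ?y"] by simp
    also have "\<rho> (?x - 1 - ?y) \<le> K * d"
      using choose_add_le[of b n d b] b(1) n(2) by (auto simp: K_def intro: less_imp_le)
    also have "\<rho> (?x - ?y) \<le> e / 2 + d"
      using triangle_diff[of ?x ?y] b(2)[OF n(1)] n(2)[of b] b(1) by simp
    finally show ?thesis using \<open>K * d + d = e / 2\<close> by simp
  qed
  then have "\<rho> 1 \<le> 0" by (rule field_le_epsilon)
  then have "\<rho> 1 = 0" using nonneg[of 1] by simp
  then have "\<rho> (int k) = 0" for k
    using scale_le[of k 1] nonneg[of "int k"] by simp
  then show ?thesis using minus by (cases c rule: int_cases2) auto
qed

end

section \<open>Return times in a chain of words of positive density\<close>

definition spread :: "int set \<Rightarrow> int \<Rightarrow> nat" where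
  "spread S n = card (S \<union> (+) n ` S)"

lemma card_translate [simp]: "card ((+) n ` S) = card S" for n :: int
  by (rule card_image) (simp add: inj_on_def)

lemma spread_0 [simp]: "spread S 0 = card S"
  by (simp add: spread_def)

text \<open>The excess of \<open>spread S n\<close> over \<open>card S\<close> is half the size of
  the symmetric difference of \<open>S\<close> and its translate; it will become a seminorm in
  \<open>n\<close>. The union is used in \<open>spread\<close> because it grows with
  \<open>S\<close>.\<close>

lemma spread_eq: "finite S \<Longrightarrow> spread S n = card S + card ((+) n ` S - S)"
  unfolding spread_def by (subst Un_Diff_cancel[symmetric], subst card_Un_disjoint) auto

lemma spread_translate: "spread ((+) p ` S) n = spread S n"
proof -
  have "(+) p ` S \<union> (+) n ` (+) p ` S = (+) p ` (S \<union> (+) n ` S)"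
    by (auto simp: image_Un image_image add.left_commute)
  then show ?thesis by (simp add: spread_def)
qed

lemma spread_minus: "spread S (- n) = spread S n"
proof -
  have "S \<union> (+) (- n) ` S = (+) (- n) ` (S \<union> (+) n ` S)"
    by (auto simp: image_Un image_image)
  then show ?thesis unfolding spread_def by (metis card_translate)
qed

lemma spread_mono: "S \<subseteq> T \<Longrightarrow> finite T \<Longrightarrow> spread S n \<le> spread T n"
  unfolding spread_def by (intro card_mono) auto

lemma spread_le: "finite S \<Longrightarrow> spread S n \<le> 2 * card S"
  using card_Un_le[of S "(+) n ` S"] by (simp add: spread_def)

text \<open>Triangle inequality for the excess over \<open>card S\<close>: if moving a point of
  \<open>S\<close> by \<open>m + n\<close> leads out of \<open>S\<close>, then either moving by
  \<open>n\<close> already does, or moving on by \<open>m\<close> does.\<close>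

lemma spread_add:
  assumes "finite S"
  shows "spread S (m + n) + card S \<le> spread S m + spread S n"
proof -
  have "(+) (m + n) ` S - S \<subseteq> (+) m ` ((+) n ` S - S) \<union> ((+) m ` S - S)"
    by (force simp: add.assoc)
  then have "card ((+) (m + n) ` S - S) \<le> card ((+) m ` ((+) n ` S - S) \<union> ((+) m ` S - S))"
    using assms by (intro card_mono) auto
  also have "\<dots> \<le> card ((+) m ` ((+) n ` S - S)) + card ((+) m ` S - S)"
    by (rule card_Un_le)
  finally show ?thesis using assms by (simp add: spread_eq)
qed

text \<open>The overlap of a set with its translate has size \<open>2 * card S - spread S n\<close>
  and grows with the set; the terms are arranged to avoid subtraction of natural numbers.\<close>

lemma spread_superset:
  assumes "S \<subseteq> T" "finite T"
  shows "spread T n + 2 * card S \<le> spread S n + 2 * card T"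
proof -
  have S: "finite S" using assms finite_subset by blast
  have "(+) n ` T - T \<subseteq> ((+) n ` S - S) \<union> (+) n ` (T - S)"
    using assms by auto
  then have "card ((+) n ` T - T) \<le> card (((+) n ` S - S) \<union> (+) n ` (T - S))"
    using assms S by (intro card_mono) auto
  also have "\<dots> \<le> card ((+) n ` S - S) + card ((+) n ` (T - S))"
    by (rule card_Un_le)
  also have "card ((+) n ` (T - S)) = card T - card S"
    using assms S by (simp add: card_Diff_subset)
  finally show ?thesis using card_mono[OF assms(2,1)] assms S by (simp add: spread_eq)
qed

section \<open>Nested words and their return times\<close>

locale word_chain =
  fixes W :: "nat \<Rightarrow> 'a list"
  assumes nested: "s \<le> t \<Longrightarrow> occ (W s) (W t) \<noteq> {}"
    and length_at_top: "filterlim (\<lambda>N. length (W N)) at_top sequentially"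
    and density: "\<exists>\<delta>>0. \<forall>N\<ge>t. \<delta> * real (length (W N)) \<le> real (card (occ (W t) (W N)))"
begin

definition ret :: "nat \<Rightarrow> int set" where
  "ret t = {q - p | p q s. p \<in> occ (W t) (W s) \<and> q \<in> occ (W t) (W s)}"

lemma retI: "p \<in> occ (W t) (W s) \<Longrightarrow> q \<in> occ (W t) (W s) \<Longrightarrow> q - p \<in> ret t"
  by (auto simp: ret_def)

lemma length_mono: "s \<le> t \<Longrightarrow> length (W s) \<le> length (W t)"
  using nested[of s t] by (auto simp: occ_def)

text \<open>Translates of \<open>occ (W t) (W N)\<close> by \<open>y 0\<close>, ...,
  \<open>y q\<close> cannot all be disjoint if \<open>q\<close> is large compared with the inverse
  density and \<open>W N\<close> is long. A common point of two of them exhibits the difference of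
  the shifts as a return time.\<close>

lemma ret_pigeonhole:
  "\<exists>q. \<forall>y :: nat \<Rightarrow> int. \<exists>r r'. r < r' \<and> r' \<le> q \<and> y r' - y r \<in> ret t"
proof -
  obtain \<delta> where \<delta>: "\<delta> > 0" "\<And>N. N \<ge> t \<Longrightarrow> \<delta> * real (length (W N)) \<le> real (card (occ (W t) (W N)))"
    using density by metis
  obtain q :: nat where "2 / \<delta> < real q" using reals_Archimedean2 by blast
  then have q: "2 \<le> real (Suc q) * \<delta>" using \<delta>(1) by (simp add: field_simps)
  have "\<exists>r r'. r < r' \<and> r' \<le> q \<and> y r' - y r \<in> ret t" for y :: "nat \<Rightarrow> int"
  proof (rule ccontr)
    assume "\<not> ?thesis"
    then have no: "\<And>r r'. r < r' \<Longrightarrow> r' \<le> q \<Longrightarrow> y r' - y r \<notin> ret t" by auto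
    define M where "M = (\<Sum>r\<le>q. nat \<bar>y r\<bar>)"
    have M: "\<bar>y r\<bar> \<le> int M" if "r \<le> q" for r
    proof -
      have "nat \<bar>y r\<bar> \<le> M"
        unfolding M_def using that by (intro member_le_sum) auto
      then show ?thesis by linarith
    qed
    \<comment> \<open>The translates lie in an interval of \<open>length (W N) + 2 * M + 1\<close>
      points, fewer than the \<open>2 * length (W N)\<close> that disjointness would force.\<close>
    have "\<forall>\<^sub>F N in sequentially. 2 * M + 2 \<le> length (W N)"
      using length_at_top by (simp add: filterlim_at_top)
    then have "\<forall>\<^sub>F N in sequentially. 2 * M + 2 \<le> length (W N) \<and> t \<le> N"
      using eventually_ge_at_top by (rule eventually_conj)
    then obtain N where N: "2 * M + 2 \<le> length (W N)" "t \<le> N"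
      by (auto simp: eventually_sequentially)
    define B where "B r = (+) (y r) ` occ (W t) (W N)" for r
    have disj: "B r \<inter> B r' = {}" if "r < r'" "r' \<le> q" for r r'
    proof (rule ccontr)
      assume "B r \<inter> B r' \<noteq> {}"
      then obtain a a' where "a \<in> occ (W t) (W N)" "a' \<in> occ (W t) (W N)" "y r + a = y r' + a'"
        by (auto simp: B_def)
      moreover from this have "y r' - y r = a - a'" by simp
      ultimately have "y r' - y r \<in> ret t" using retI[of a' t N a] by simp
      then show False using no that by blast
    qed
    have "card (\<Union>r\<le>q. B r) = (\<Sum>r\<le>q. card (B r))"
    proof (rule card_UN_disjoint)
      show "\<forall>i\<in>{..q}. \<forall>j\<in>{..q}. i \<noteq> j \<longrightarrow> B i \<inter> B j = {}"
        using disj by (metis Int_commute atMost_iff nat_neq_iff)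
    qed (auto simp: B_def finite_occ)
    also have "\<dots> = Suc q * card (occ (W t) (W N))" by (simp add: B_def)
    finally have card: "card (\<Union>r\<le>q. B r) = Suc q * card (occ (W t) (W N))" .
    have "2 * real (length (W N)) \<le> real (Suc q) * (\<delta> * real (length (W N)))"
      using q mult_right_mono[of 2 "real (Suc q) * \<delta>" "real (length (W N))"] by (simp only: mult.assoc)
    also have "\<dots> \<le> real (Suc q) * real (card (occ (W t) (W N)))"
      using \<delta>(2)[OF N(2)] by (intro mult_left_mono) auto
    also have "\<dots> = real (card (\<Union>r\<le>q. B r))" unfolding card by (rule of_nat_mult[symmetric])
    also have "\<dots> \<le> real (card {- int M..int (length (W N)) + int M})"
    proof -
      have "(\<Union>r\<le>q. B r) \<subseteq> {- int M..int (length (W N)) + int M}"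
        using M occ_subset_atLeastAtMost[of "W t" "W N"] by (force simp: B_def abs_le_iff)
      then show ?thesis by (intro of_nat_mono card_mono) auto
    qed
    also have "\<dots> = real (length (W N) + 2 * M + 1)" by simp
    finally show False using N(1) by simp
  qed
  then show ?thesis by blast
qed

text \<open>
  The overlap of \<open>diffset u t N\<close> with its translates stabilises as \<open>N \<rightarrow> \<infinity>\<close> and then \<open>t \<rightarrow> \<infinity>\<close>: if \<open>d\<close> is a
  return time of \<open>W t\<close> in \<open>W s\<close>, then a translate of \<open>diffset u s N\<close> contains both \<open>diffset u t N\<close> and
  its translate by \<open>d\<close>, so that translating by \<open>d\<close> moves few points once the density of
  \<open>diffset u t N\<close> is close to its supremum over \<open>t\<close>.
\<close>

definition diffset :: "nat \<Rightarrow> nat \<Rightarrow> nat \<Rightarrow> int set" where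
  "diffset u t N = (\<lambda>(a, b). a - b) ` (occ (W u) (W N) \<times> occ (W u) (W t))"

lemma finite_diffset: "finite (diffset u t N)"
  by (simp add: diffset_def finite_occ)

lemma diffset_translate:
  assumes "p \<in> occ (W t) (W s)"
  shows "(+) (- p) ` diffset u t N \<subseteq> diffset u s N"
proof
  fix x assume "x \<in> (+) (- p) ` diffset u t N"
  then obtain a b where ab: "a \<in> occ (W u) (W N)" "b \<in> occ (W u) (W t)" "x = a - (b + p)"
    by (auto simp: diffset_def)
  then show "x \<in> diffset u s N"
    using occ_trans[OF ab(2) assms] by (force simp: diffset_def)
qed

lemma card_diffset_le: "card (diffset u t N) \<le> length (W N) + length (W t) + 1"
proof -
  have "diffset u t N \<subseteq> {- int (length (W t))..int (length (W N))}"
    using occ_subset_atLeastAtMost[of "W u" "W N"] occ_subset_atLeastAtMost[of "W u" "W t"]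
    by (force simp: diffset_def)
  then have "card (diffset u t N) \<le> card {- int (length (W t))..int (length (W N))}"
    by (intro card_mono) auto
  then show ?thesis by simp
qed

lemma card_diffset_ge:
  assumes "u \<le> t"
  shows "card (occ (W u) (W N)) \<le> card (diffset u t N)"
proof -
  obtain b where "b \<in> occ (W u) (W t)" using nested[OF assms] by blast
  then have "(+) (- b) ` occ (W u) (W N) \<subseteq> diffset u t N"
    by (force simp: diffset_def)
  from card_mono[OF finite_diffset this] show ?thesis by (simp only: card_translate)
qed

text \<open>Up to a translation, which changes neither \<open>spread\<close> nor
  \<open>card\<close>, \<open>diffset u s N\<close> is contained in
  \<open>diffset u t N\<close>.\<close>

lemma spread_diffset_mono:
  assumes "s \<le> t"
  shows "spread (diffset u s N) n \<le> spread (diffset u t N) n"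
    and "spread (diffset u t N) n + 2 * card (diffset u s N)
      \<le> spread (diffset u s N) n + 2 * card (diffset u t N)"
proof -
  obtain p where p: "p \<in> occ (W s) (W t)" using nested[OF assms] by blast
  note sub = diffset_translate[OF p, of u N]
  show "spread (diffset u s N) n \<le> spread (diffset u t N) n"
    using spread_mono[OF sub finite_diffset] by (simp only: spread_translate)
  show "spread (diffset u t N) n + 2 * card (diffset u s N)
      \<le> spread (diffset u s N) n + 2 * card (diffset u t N)"
    using spread_superset[OF sub finite_diffset] by (simp only: spread_translate card_translate)
qed

lemma spread_diffset_return:
  assumes "p \<in> occ (W t) (W s)" "q \<in> occ (W t) (W s)"
  shows "spread (diffset u t N) (q - p) \<le> card (diffset u s N)"
proof -
  let ?S = "diffset u t N"
  have "spread ?S (q - p) = card ((+) (- q) ` (?S \<union> (+) (q - p) ` ?S))"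
    by (simp only: spread_def card_translate)
  also have "(+) (- q) ` (?S \<union> (+) (q - p) ` ?S) = (+) (- q) ` ?S \<union> (+) (- p) ` ?S"
    by (auto simp: image_Un image_image)
  also have "card \<dots> \<le> card (diffset u s N)"
    using diffset_translate[OF assms(1)] diffset_translate[OF assms(2)]
    by (intro card_mono finite_diffset) auto
  finally show ?thesis .
qed

text \<open>There are only countably many pairs \<open>(t, n)\<close>, so a diagonal subsequence
  serves all of them.\<close>

lemma exists_limit_spread:
  obtains k :: "nat \<Rightarrow> nat" and g :: "nat \<Rightarrow> int \<Rightarrow> real"
  where "strict_mono k"
    and "\<And>t n. (\<lambda>i. spread (diffset u t (k i)) n / length (W (k i))) \<longlonglongrightarrow> g t n"
proof -
  \<comment> \<open>The default 0 for \<open>N < t\<close> makes the bound uniform: for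
    \<open>t \<le> N\<close> and \<open>L = length (W N) > 0\<close> the spread is at most
    \<open>2 * (L + L + 1) \<le> 6 * L\<close>. Each \<open>t\<close> meets the default at finitely
    many indices only.\<close>
  define f :: "nat \<Rightarrow> nat \<times> int \<Rightarrow> real" where
    "f N = (\<lambda>(t, n). if N < t then 0 else spread (diffset u t N) n / length (W N))" for N
  have bound: "norm (f N x) \<le> 6" for N x
  proof (cases x)
    case (Pair t n)
    show ?thesis
    proof (cases "N < t \<or> length (W N) = 0")
      case False
      then have "1 \<le> length (W N)" "length (W t) \<le> length (W N)"
        by (simp_all add: length_mono Suc_le_eq)
      then have "spread (diffset u t N) n \<le> 6 * length (W N)"
        using spread_le[OF finite_diffset[of u t N], of n] card_diffset_le[of u t N] by linarith
      then have "real (spread (diffset u t N) n) \<le> 6 * real (length (W N))" by linarith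
      then show ?thesis using False Pair by (simp add: f_def field_simps)
    qed (auto simp: f_def Pair)
  qed
  obtain k where k: "strict_mono k" "\<And>x. \<exists>l. (\<lambda>i. f (k i) x) \<longlonglongrightarrow> l"
    using function_convergent_subsequence[of UNIV f 6] bound by (metis UNIV_I countableI_type)
  define g where "g t n = lim (\<lambda>i. f (k i) (t, n))" for t n
  have "(\<lambda>i. spread (diffset u t (k i)) n / length (W (k i))) \<longlonglongrightarrow> g t n" for t n
  proof (rule Lim_transform_eventually)
    show "(\<lambda>i. f (k i) (t, n)) \<longlonglongrightarrow> g t n"
      using k(2)[of "(t, n)"] unfolding g_def by (metis convergentI convergent_LIMSEQ_iff)
    have "k i \<ge> t" if "i \<ge> t" for i using seq_suble[OF k(1), of i] that by simp
    then show "\<forall>\<^sub>F i in sequentially. f (k i) (t, n) = spread (diffset u t (k i)) n / length (W (k i))"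
      unfolding eventually_sequentially f_def by (intro exI[of _ t]) force
  qed
  then show ?thesis using k(1) that by blast
qed

theorem exists_seminorm:
  obtains \<rho> where "totally_bounded_int_seminorm \<rho>"
    and "\<And>e. e > 0 \<Longrightarrow> \<exists>t. \<forall>d\<in>ret t. \<rho> d \<le> e"
    and "\<And>c. \<rho> c = 0 \<Longrightarrow> \<exists>N t. \<exists>a\<in>occ (W u) (W N). \<exists>b\<in>occ (W u) (W N).
           \<exists>a'\<in>occ (W u) (W t). \<exists>b'\<in>occ (W u) (W t). c = (a - b) - (a' - b')"
proof -
  obtain k g where k: "strict_mono k"
    and g: "\<And>t n. (\<lambda>i. spread (diffset u t (k i)) n / length (W (k i))) \<longlonglongrightarrow> g t n"
    using exists_limit_spread by metis
  define h where "h t n i = real (spread (diffset u t (k i)) n) / real (length (W (k i)))" for t n i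
  have h: "h t n \<longlonglongrightarrow> g t n" for t n using g unfolding h_def .
  have g_mono: "g s n \<le> g t n" if "s \<le> t" for s t n
    using spread_diffset_mono(1)[OF that]
    by (intro LIMSEQ_le[OF h h]) (auto simp: h_def intro!: divide_right_mono)
  have g_superset: "g t n + 2 * g s 0 \<le> g s n + 2 * g t 0" if "s \<le> t" for s t n
  proof (rule LIMSEQ_le)
    show "(\<lambda>i. h t n i + 2 * h s 0 i) \<longlonglongrightarrow> g t n + 2 * g s 0"
      "(\<lambda>i. h s n i + 2 * h t 0 i) \<longlonglongrightarrow> g s n + 2 * g t 0"
      by (intro tendsto_intros h)+
    have "h t n i + 2 * h s 0 i \<le> h s n i + 2 * h t 0 i" for i
    proof -
      have "real (spread (diffset u t (k i)) n) + 2 * real (card (diffset u s (k i)))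
          \<le> real (spread (diffset u s (k i)) n) + 2 * real (card (diffset u t (k i)))"
        using spread_diffset_mono(2)[OF that, of u "k i" n] by linarith
      from divide_right_mono[OF this, of "real (length (W (k i)))"]
      show ?thesis by (simp add: h_def add_divide_distrib)
    qed
    then show "\<exists>N. \<forall>i\<ge>N. h t n i + 2 * h s 0 i \<le> h s n i + 2 * h t 0 i" by blast
  qed
  have g_return: "g t (q - p) \<le> g s 0" if "p \<in> occ (W t) (W s)" "q \<in> occ (W t) (W s)" for p q s t
    using spread_diffset_return[OF that]
    by (intro LIMSEQ_le[OF h h]) (auto simp: h_def intro!: divide_right_mono)
  have g_add: "g t (m + n) + g t 0 \<le> g t m + g t n" for t m n
  proof (rule LIMSEQ_le)
    show "(\<lambda>i. h t (m + n) i + h t 0 i) \<longlonglongrightarrow> g t (m + n) + g t 0"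
      "(\<lambda>i. h t m i + h t n i) \<longlonglongrightarrow> g t m + g t n"
      by (intro tendsto_intros h)+
    have "h t (m + n) i + h t 0 i \<le> h t m i + h t n i" for i
    proof -
      have "real (spread (diffset u t (k i)) (m + n)) + real (card (diffset u t (k i)))
          \<le> real (spread (diffset u t (k i)) m) + real (spread (diffset u t (k i)) n)"
        using spread_add[OF finite_diffset, of u t "k i" m n] by linarith
      from divide_right_mono[OF this, of "real (length (W (k i)))"]
      show ?thesis by (simp add: h_def add_divide_distrib)
    qed
    then show "\<exists>N. \<forall>i\<ge>N. h t (m + n) i + h t 0 i \<le> h t m i + h t n i" by blast
  qed
  have g_minus: "g t (- n) = g t n" for t n
  proof (rule LIMSEQ_unique[OF h])
    have "h t (- n) = h t n" by (simp add: h_def spread_minus fun_eq_iff)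
    then show "h t (- n) \<longlonglongrightarrow> g t n" using h[of t n] by simp
  qed
  have len_k: "\<forall>\<^sub>F i in sequentially. t \<le> k i \<and> 1 \<le> length (W (k i))" for t
  proof -
    have "filterlim (\<lambda>i. length (W (k i))) at_top sequentially"
      using filterlim_compose[OF length_at_top filterlim_subseq[OF k]] .
    then have "\<forall>\<^sub>F i in sequentially. 1 \<le> length (W (k i))"
      by (simp add: filterlim_at_top)
    moreover have "\<forall>\<^sub>F i in sequentially. t \<le> k i"
      using filterlim_subseq[OF k] by (simp add: filterlim_at_top)
    ultimately show ?thesis by eventually_elim simp
  qed
  have g_bound: "g t n \<le> 6" for t n
  proof (rule tendsto_upperbound[OF h])
    show "\<forall>\<^sub>F i in sequentially. h t n i \<le> 6"
      using len_k[of t]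
    proof eventually_elim
      case (elim i)
      then have "spread (diffset u t (k i)) n \<le> 6 * length (W (k i))"
        using spread_le[OF finite_diffset[of u t "k i"], of n] card_diffset_le[of u t "k i"]
          length_mono[of t "k i"] by linarith
      then have "real (spread (diffset u t (k i)) n) \<le> 6 * real (length (W (k i)))" by linarith
      then show ?case using elim by (simp add: h_def divide_le_eq)
    qed
  qed simp
  have "\<exists>G. (\<lambda>t. g t n) \<longlonglongrightarrow> G" for n
    using incseq_convergent[of "\<lambda>t. g t n" 6] g_mono g_bound by (metis incseq_def)
  then obtain G where G: "\<And>n. (\<lambda>t. g t n) \<longlonglongrightarrow> G n" by metis
  have g_le_G: "g t n \<le> G n" for t n
    using incseq_le[OF _ G] g_mono by (simp add: incseq_def)
  \<comment> \<open>\<open>G 0\<close> is the limiting normalised cardinality, so this is the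
    limiting normalised excess of \<open>spread\<close> over \<open>card\<close>.\<close>
  define \<rho> where "\<rho> n = G n - G 0" for n
  have seminorm: "int_seminorm \<rho>"
  proof
    show "\<rho> 0 = 0" by (simp add: \<rho>_def)
    show "\<rho> (- n) = \<rho> n" for n
      using LIMSEQ_unique[OF G[of "- n", unfolded g_minus] G[of n]] by (simp add: \<rho>_def)
    have "G (m + n) + G 0 \<le> G m + G n" for m n
    proof (rule LIMSEQ_le)
      show "(\<lambda>t. g t (m + n) + g t 0) \<longlonglongrightarrow> G (m + n) + G 0" "(\<lambda>t. g t m + g t n) \<longlonglongrightarrow> G m + G n"
        by (intro tendsto_intros G)+
    qed (use g_add in blast)
    then show "\<rho> (m + n) \<le> \<rho> m + \<rho> n" for m n
      by (simp add: \<rho>_def algebra_simps)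
  qed
  have ret_bound: "\<rho> d \<le> 2 * (G 0 - g t 0)" if d: "d \<in> ret t" for d t
  proof -
    obtain p q s where "d = q - p" "p \<in> occ (W t) (W s)" "q \<in> occ (W t) (W s)"
      using d by (auto simp: ret_def)
    then have "g t d \<le> G 0" using g_return[of p t s q] g_le_G[of s 0] by simp
    \<comment> \<open>Letting the later stage in \<open>g_superset\<close> tend to infinity bounds
      \<open>G d\<close> by \<open>g t d\<close>, up to twice the cardinality still to be
      gained.\<close>
    have "G d + 2 * g t 0 \<le> g t d + 2 * G 0"
    proof (rule LIMSEQ_le)
      show "(\<lambda>s. g s d + 2 * g t 0) \<longlonglongrightarrow> G d + 2 * g t 0" "(\<lambda>s. g t d + 2 * g s 0) \<longlonglongrightarrow> g t d + 2 * G 0"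
        by (intro tendsto_intros G)+
    qed (use g_superset in blast)
    then show ?thesis using \<open>g t d \<le> G 0\<close> by (simp add: \<rho>_def)
  qed
  have ret_small: "\<exists>t. \<forall>d\<in>ret t. \<rho> d \<le> e" if "e > 0" for e
  proof -
    have "\<forall>\<^sub>F t in sequentially. G 0 - e / 2 < g t 0"
      using order_tendstoD(1)[OF G[of 0]] that by simp
    then obtain t where "G 0 - e / 2 < g t 0" by (auto simp: eventually_sequentially)
    then have "\<rho> d \<le> e" if "d \<in> ret t" for d using ret_bound[OF that] by simp
    then show ?thesis by blast
  qed
  have "totally_bounded_int_seminorm \<rho>"
  proof (intro totally_bounded_int_seminorm.intro seminorm totally_bounded_int_seminorm_axioms.intro)
    fix e :: real assume "e > 0"
    then show "\<exists>q. \<forall>y :: nat \<Rightarrow> int. \<exists>r r'. r < r' \<and> r' \<le> q \<and> \<rho> (y r' - y r) \<le> e"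
      using ret_small ret_pigeonhole by metis
  qed
  moreover have "\<exists>N t. \<exists>a\<in>occ (W u) (W N). \<exists>b\<in>occ (W u) (W N).
           \<exists>a'\<in>occ (W u) (W t). \<exists>b'\<in>occ (W u) (W t). c = (a - b) - (a' - b')" if c: "\<rho> c = 0" for c
  proof (rule ccontr)
    assume not: "\<not> ?thesis"
    \<comment> \<open>Disjointness from the translates by \<open>c\<close> will give
      \<open>G c = 2 * G 0\<close>, so that \<open>\<rho> c = 0\<close> forces
      \<open>G 0 = 0\<close>, against the positive density of \<open>W u\<close>.\<close>
    have "diffset u t N \<inter> (+) c ` diffset u t N = {}" for t N
    proof (rule ccontr)
      assume "\<not> ?thesis"
      then obtain a a' b b' where "a \<in> occ (W u) (W N)" "b \<in> occ (W u) (W N)"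
        "a' \<in> occ (W u) (W t)" "b' \<in> occ (W u) (W t)" "a - a' = c + (b - b')"
        by (auto simp: diffset_def)
      then have "c = (a - b) - (a' - b')" by simp
      then show False using not \<open>a \<in> _\<close> \<open>b \<in> _\<close> \<open>a' \<in> _\<close> \<open>b' \<in> _\<close> by blast
    qed
    then have "spread (diffset u t N) c = 2 * card (diffset u t N)" for t N
      by (simp add: spread_def card_Un_disjoint finite_diffset)
    then have "h t c = (\<lambda>i. 2 * h t 0 i)" for t by (auto simp: h_def)
    then have "g t c = 2 * g t 0" for t
      using LIMSEQ_unique[OF h[of t c]] tendsto_mult[OF tendsto_const[of 2] h[of t 0]] by metis
    then have "G c = 2 * G 0"
      using LIMSEQ_unique[OF G[of c]] tendsto_mult[OF tendsto_const[of 2] G[of 0]] by simp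
    then have "G 0 = 0" using c by (simp add: \<rho>_def)
    obtain \<delta> where \<delta>: "\<delta> > 0" "\<And>N. N \<ge> u \<Longrightarrow> \<delta> * real (length (W N)) \<le> real (card (occ (W u) (W N)))"
      using density by metis
    have "\<delta> \<le> g u 0"
    proof (rule tendsto_lowerbound[OF h])
      show "\<forall>\<^sub>F i in sequentially. \<delta> \<le> h u 0 i"
        using len_k[of u]
      proof eventually_elim
        case (elim i)
        then have "\<delta> * real (length (W (k i))) \<le> real (card (diffset u u (k i)))"
          using \<delta>(2)[of "k i"] card_diffset_ge[of u u "k i"] by linarith
        then show ?case using elim by (auto simp: h_def le_divide_eq)
      qed
    qed simp
    then show False using \<delta>(1) g_le_G[of u 0] \<open>G 0 = 0\<close> by simp
  qed
  ultimately show ?thesis using that ret_small by blast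
qed

end

section \<open>Topological weak mixing\<close>

interpretation core: word_chain core
proof
  show "occ (core s) (core t) \<noteq> {}" if "s \<le> t" for s t
    using that by (rule occ_core_nonempty)
  show "filterlim (\<lambda>N. length (core N)) at_top sequentially"
    by (rule length_core_at_top)
  show "\<exists>\<delta>>0. \<forall>N\<ge>t. \<delta> * real (length (core N)) \<le> real (card (occ (core t) (core N)))" for t
  proof (intro exI[of _ "1 / 4 ^ Suc t"] conjI allI impI)
    fix N assume "t \<le> N"
    then have "real (length (core N)) \<le> real (4 ^ Suc t * card (occ (core t) (core N)))"
      using density_core of_nat_mono by blast
    then show "1 / 4 ^ Suc t * real (length (core N)) \<le> real (card (occ (core t) (core N)))"
      by (simp add: field_simps)
  qed simp
qed

lemma core_return_differences:
  "\<exists>N t. \<exists>a\<in>occ (core u) (core N). \<exists>b\<in>occ (core u) (core N).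
     \<exists>a'\<in>occ (core u) (core t). \<exists>b'\<in>occ (core u) (core t). c = (a - b) - (a' - b')"
proof (rule core.exists_seminorm[of u])
  fix \<rho> assume \<rho>: "totally_bounded_int_seminorm \<rho>"
    and small: "\<And>e. e > 0 \<Longrightarrow> \<exists>t. \<forall>d\<in>core.ret t. \<rho> d \<le> e"
    and zero: "\<And>c. \<rho> c = 0 \<Longrightarrow> \<exists>N t. \<exists>a\<in>occ (core u) (core N). \<exists>b\<in>occ (core u) (core N).
           \<exists>a'\<in>occ (core u) (core t). \<exists>b'\<in>occ (core u) (core t). c = (a - b) - (a' - b')"
  have "\<exists>b\<ge>1. \<forall>n\<ge>b. \<rho> (int ((b + n) choose b)) \<le> e" if e: "e > 0" for e
  proof -
    obtain t where t: "\<And>d. d \<in> core.ret t \<Longrightarrow> \<rho> d \<le> e" using small[OF e] by blast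
    have "int ((Suc t + n) choose Suc t) \<in> core.ret t" if n: "n \<ge> Suc t" for n
    proof -
      obtain s p where "p \<in> occ (core t) (core s)"
        "p + int ((Suc t + n) choose Suc t) \<in> occ (core t) (core s)"
        using binomial_return[OF lessI Suc_le_lessD[OF n]] by metis
      from core.retI[OF this] show ?thesis by simp
    qed
    then show ?thesis using t by (intro exI[of _ "Suc t"]) auto
  qed
  then have "\<rho> c = 0" by (rule totally_bounded_int_seminorm.seminorm_trivial[OF \<rho>])
  then show ?thesis by (rule zero)
qed

text \<open>All four words occur in a common \<open>core t\<close>. The two distances there may
  differ by some \<open>c\<close>, which \<open>core_return_differences\<close> makes up for by one
  return time of \<open>core t\<close> in each coordinate.\<close>

lemma zeta_language_product_transitive:
  assumes "w \<in> zeta_language" "u \<in> zeta_language" "w' \<in> zeta_language" "u' \<in> zeta_language"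
  obtains v v' p q p' q' where "v \<in> zeta_language" "v' \<in> zeta_language"
    "p \<in> occ w v" "q \<in> occ u v" "p' \<in> occ w' v'" "q' \<in> occ u' v'" "q - p = q' - p'"
proof -
  have "\<exists>t0. \<forall>t\<ge>t0. occ x (core t) \<noteq> {}" if x: "x \<in> zeta_language" for x
  proof -
    obtain s where "sublist x (core s)" using x by (auto simp: mem_zeta_language_iff)
    then have "occ x (core t) \<noteq> {}" if "s \<le> t" for t
      using occ_core_nonempty[OF that] unfolding sublist_iff_occ[symmetric]
      by (rule sublist_order.order_trans)
    then show ?thesis by blast
  qed
  then have "\<forall>\<^sub>F t in sequentially. occ x (core t) \<noteq> {}" if "x \<in> zeta_language" for x
    using that by (simp add: eventually_sequentially)
  note this[OF assms(1)] this[OF assms(2)] this[OF assms(3)] this[OF assms(4)]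
  then have "\<forall>\<^sub>F t in sequentially. occ w (core t) \<noteq> {} \<and> occ u (core t) \<noteq> {} \<and>
      occ w' (core t) \<noteq> {} \<and> occ u' (core t) \<noteq> {}"
    by eventually_elim simp
  then obtain t where "occ w (core t) \<noteq> {}" "occ u (core t) \<noteq> {}"
      "occ w' (core t) \<noteq> {}" "occ u' (core t) \<noteq> {}"
    using eventually_happens'[OF sequentially_bot] by blast
  then obtain p q p' q' where pq: "p \<in> occ w (core t)" "q \<in> occ u (core t)"
    "p' \<in> occ w' (core t)" "q' \<in> occ u' (core t)" by blast
  obtain N s a b a' b' where ab: "a \<in> occ (core t) (core N)" "b \<in> occ (core t) (core N)"
    "a' \<in> occ (core t) (core s)" "b' \<in> occ (core t) (core s)"
    "(q' - p') - (q - p) = (a - b) - (a' - b')"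
    using core_return_differences[of t "(q' - p') - (q - p)"] by blast
  show ?thesis
  proof (rule that)
    show "core N \<in> zeta_language" "core s \<in> zeta_language"
      by (auto simp: mem_zeta_language_iff)
    show "p + b \<in> occ w (core N)" "q + a \<in> occ u (core N)"
      "p' + b' \<in> occ w' (core s)" "q' + a' \<in> occ u' (core s)"
      using pq ab by (auto intro: occ_trans)
    show "q + a - (p + b) = q' + a' - (p' + b')" using ab(5) by simp
  qed
qed

section \<open>Sequences in which all words of the language occur\<close>

definition occurs_at :: "(int \<Rightarrow> 'a) \<Rightarrow> int \<Rightarrow> 'a list \<Rightarrow> bool" where
  "occurs_at x m w \<longleftrightarrow> (\<forall>i<length w. x (m + int i) = w ! i)"

lemma occurs_at_occ:
  assumes "occurs_at x m w" "p \<in> occ u w"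
  shows "occurs_at x (m + p) u"
proof -
  obtain xs ys where w: "w = xs @ u @ ys" "p = int (length xs)"
    using assms(2) by (auto simp: occ_def)
  have "x (m + p + int i) = u ! i" if "i < length u" for i
  proof -
    have "x (m + int (length xs + i)) = w ! (length xs + i)"
      using assms(1) that w unfolding occurs_at_def by (metis length_append nat_add_left_cancel_less trans_less_add1)
    moreover have "w ! (length xs + i) = u ! i" using that w by (simp add: nth_append)
    ultimately show ?thesis using w by (simp add: add.assoc)
  qed
  then show ?thesis by (simp add: occurs_at_def)
qed

text \<open>A margin of one letter on both sides makes the nested words exhaust the integers in both
  directions.\<close>

lemma core_interior:
  obtains p where "p \<in> occ (core t) (core (Suc t))" "1 \<le> p"
    "p + int (length (core t)) + 1 \<le> int (length (core (Suc t)))"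
proof
  have eq: "core (Suc t) = pword (Suc (Suc t)) t @ core t @ (core t @ pword t (Suc (Suc t)))"
    by (simp add: core_def pword_Suc_Suc)
  show "int (length (pword (Suc (Suc t)) t)) \<in> occ (core t) (core (Suc t))"
    using occI[OF eq] .
  have "1 \<le> length (core t)" "1 \<le> length (pword (Suc (Suc t)) t)"
    by (simp_all add: core_def Suc_le_eq)
  then show "1 \<le> int (length (pword (Suc (Suc t)) t))"
    "int (length (pword (Suc (Suc t)) t)) + int (length (core t)) + 1 \<le> int (length (core (Suc t)))"
    unfolding eq length_append of_nat_add by linarith+
qed

lemma shift_in_Sigma_set: "x \<in> Sigma_set \<Longrightarrow> (\<lambda>n. x (n + k)) \<in> Sigma_set"
proof -
  have "map (\<lambda>n. x (n + k)) [i..j] = map x [i + k..j + k]" for i j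
    by (rule nth_equalityI) (auto simp: add_ac)
  then show "x \<in> Sigma_set \<Longrightarrow> (\<lambda>n. x (n + k)) \<in> Sigma_set"
    by (simp add: Sigma_set_def)
qed

lemma exists_point_core: "\<exists>x\<in>Sigma_set. \<exists>m. \<forall>s. occurs_at x (m s) (core s)"
proof -
  obtain d where d: "\<And>s. d s \<in> occ (core s) (core (Suc s))" "\<And>s. 1 \<le> d s"
    "\<And>s. d s + int (length (core s)) + 1 \<le> int (length (core (Suc s)))"
  proof -
    have "\<exists>d. \<forall>s. d s \<in> occ (core s) (core (Suc s)) \<and> 1 \<le> d s \<and>
        d s + int (length (core s)) + 1 \<le> int (length (core (Suc s)))"
      by (rule choice) (meson core_interior)
    then show thesis using that by blast
  qed
  \<comment> \<open>\<open>P s\<close> is the place of the origin in \<open>core s\<close>, which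
    then occupies the window \<open>R s\<close> of integers.\<close>
  define P where "P s = (\<Sum>r<s. d r)" for s
  have P_Suc: "P (Suc s) = P s + d s" for s by (simp add: P_def)
  have P_ge: "int s \<le> P s \<and> int s \<le> int (length (core s)) - P s" for s
  proof (induction s)
    case (Suc s)
    then show ?case using d(2,3)[of s] P_Suc[of s] by simp
  qed (simp add: P_def)
  define R where "R s = {n. 0 \<le> n + P s \<and> n + P s < int (length (core s))}" for s
  have step: "n \<in> R (Suc s) \<and> core (Suc s) ! nat (n + P (Suc s)) = core s ! nat (n + P s)"
    if "n \<in> R s" for n s
  proof -
    obtain xs ys where xs: "core (Suc s) = xs @ core s @ ys" "d s = int (length xs)"
      using d(1)[of s] by (auto simp: occ_def)
    then have "nat (n + P (Suc s)) = length xs + nat (n + P s)"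
      using that by (auto simp: R_def P_Suc)
    then show ?thesis using that xs by (auto simp: R_def P_Suc nth_append)
  qed
  have agree: "n \<in> R (s + j) \<and> core (s + j) ! nat (n + P (s + j)) = core s ! nat (n + P s)"
    if "n \<in> R s" for n s j
    by (induction j) (use that step in auto)
  \<comment> \<open>By \<open>P_ge\<close> the window \<open>R s\<close> contains all integers of
    absolute value less than \<open>s\<close>, so this stage is late enough to determine
    \<open>x n\<close>.\<close>
  define x where "x n = (let s = Suc (nat \<bar>n\<bar>) in core s ! nat (n + P s))" for n
  have inR: "n \<in> R s" if "\<bar>n\<bar> < int s" for n s
    using P_ge[of s] that by (auto simp: R_def)
  have x: "x n = core s ! nat (n + P s)" if "n \<in> R s" for n s
  proof -
    have "n \<in> R (Suc (nat \<bar>n\<bar>))" by (rule inR) simp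
    then show ?thesis
      using agree[of n "Suc (nat \<bar>n\<bar>)" s] agree[OF that, of "Suc (nat \<bar>n\<bar>)"]
      by (simp add: x_def add.commute)
  qed
  have "x \<in> Sigma_set"
    unfolding Sigma_set_def mem_Collect_eq
  proof (intro allI)
    fix k l :: int
    define s where "s = Suc (nat (max \<bar>k\<bar> \<bar>l\<bar>))"
    have inR': "n \<in> R s" if "k \<le> n" "n \<le> l" for n
      using that by (intro inR) (auto simp: s_def)
    have "map x [k..l] = take (nat (l - k + 1)) (drop (nat (k + P s)) (core s))" if "k \<le> l"
    proof (rule nth_equalityI)
      have kl: "k \<in> R s" "l \<in> R s" using inR' that by auto
      then show len: "length (map x [k..l]) = length (take (nat (l - k + 1)) (drop (nat (k + P s)) (core s)))"
        by (auto simp: R_def)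
      fix i assume i: "i < length (map x [k..l])"
      then have "x (k + int i) = core s ! nat (k + int i + P s)"
        using x[OF inR'] by simp
      moreover have "nat (k + int i + P s) = nat (k + P s) + i" using kl by (auto simp: R_def)
      ultimately show "map x [k..l] ! i = take (nat (l - k + 1)) (drop (nat (k + P s)) (core s)) ! i"
        using i that kl by (simp add: R_def nth_drop)
    qed
    moreover have "sublist (take a (drop b (core s))) (core s)" for a b
      by (meson sublist_drop sublist_take sublist_order.order_trans)
    ultimately show "map x [k..l] \<in> zeta_language"
      unfolding mem_zeta_language_iff by (cases "k \<le> l") auto
  qed
  moreover have "occurs_at x (- P s) (core s)" for s
    unfolding occurs_at_def
  proof (intro allI impI)
    fix i assume "i < length (core s)"
    then show "x (- P s + int i) = core s ! i"
      using x[of "- P s + int i" s] by (simp add: R_def)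
  qed
  ultimately show ?thesis by (intro bexI exI[of _ "\<lambda>s. - P s"]) auto
qed

lemma exists_point:
  assumes "w \<in> zeta_language"
  obtains x where "x \<in> Sigma_set" "occurs_at x m w"
proof -
  obtain x k where x: "x \<in> Sigma_set" "\<And>s. occurs_at x (k s) (core s)"
    using exists_point_core by blast
  obtain s p where p: "p \<in> occ w (core s)"
    using assms by (auto simp: mem_zeta_language_iff sublist_iff_occ)
  define j where "j = k s + p"
  have "occurs_at x j w" using occurs_at_occ[OF x(2) p] by (simp add: j_def)
  then have "occurs_at (\<lambda>n. x (n + (j - m))) m w"
    by (auto simp: occurs_at_def algebra_simps)
  then show ?thesis using that shift_in_Sigma_set[OF x(1)] by blast
qed

section \<open>Cylinder neighbourhoods\<close>

lemma openin_Sigma_space_cylinder: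
  assumes "finite I"
  shows "openin Sigma_space {x \<in> Sigma_set. \<forall>i\<in>I. x i = c i}"
  using assms
proof (induction I rule: finite_induct)
  case empty
  then show ?case using openin_topspace[of Sigma_space] by simp
next
  case (insert j I)
  have "continuous_map Sigma_space (discrete_topology UNIV) (\<lambda>x. x j)"
    unfolding Sigma_space_def
    by (intro continuous_map_from_subtopology continuous_map_product_projection) simp
  then have "openin Sigma_space {x \<in> topspace Sigma_space. x j \<in> {c j}}"
    by (rule openin_continuous_map_preimage) simp
  then have "openin Sigma_space ({x \<in> Sigma_set. x j = c j} \<inter> {x \<in> Sigma_set. \<forall>i\<in>I. x i = c i})"
    using insert.IH by (intro openin_Int) simp_all
  also have "{x \<in> Sigma_set. x j = c j} \<inter> {x \<in> Sigma_set. \<forall>i\<in>I. x i = c i}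
      = {x \<in> Sigma_set. \<forall>i\<in>insert j I. x i = c i}" by auto
  finally show ?case .
qed

lemma openin_occurs_at: "openin Sigma_space {x \<in> Sigma_set. occurs_at x n w}"
proof -
  let ?I = "(\<lambda>i. n + int i) ` {..<length w}"
  have "{x \<in> Sigma_set. occurs_at x n w} = {x \<in> Sigma_set. \<forall>i\<in>?I. x i = w ! nat (i - n)}"
    by (auto simp: occurs_at_def)
  moreover have "openin Sigma_space {x \<in> Sigma_set. \<forall>i\<in>?I. x i = w ! nat (i - n)}"
    by (rule openin_Sigma_space_cylinder) simp
  ultimately show ?thesis by simp
qed

text \<open>All larger windows are included so that two points can be given a common window in the
  product.\<close>

lemma Sigma_space_nbhd:
  assumes "openin Sigma_space U" "x \<in> U"
  obtains m :: nat where "\<And>y m'. y \<in> Sigma_set \<Longrightarrow> m \<le> m' \<Longrightarrow>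
    occurs_at y (- int m') (map x [- int m'..int m']) \<Longrightarrow> y \<in> U"
proof -
  obtain V where V: "openin full_space V" "U = V \<inter> Sigma_set"
    using assms(1) by (auto simp: Sigma_space_def openin_subtopology)
  then have "x \<in> V" using assms(2) by simp
  then obtain B where B: "finite {i. B i \<noteq> UNIV}" "x \<in> Pi\<^sub>E UNIV B" "Pi\<^sub>E UNIV B \<subseteq> V"
    using V(1) unfolding openin_product_topology_alt by fastforce
  define m where "m = nat (\<Sum>i | B i \<noteq> UNIV. \<bar>i\<bar>)"
  have m: "\<bar>i\<bar> \<le> int m" if "B i \<noteq> UNIV" for i
  proof -
    have "\<bar>i\<bar> \<le> (\<Sum>i | B i \<noteq> UNIV. \<bar>i\<bar>)"
      using B(1) that by (intro member_le_sum) auto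
    then show ?thesis unfolding m_def by linarith
  qed
  have "y \<in> U" if y: "y \<in> Sigma_set" "m \<le> m'"
    "occurs_at y (- int m') (map x [- int m'..int m'])" for y m'
  proof -
    have eq: "y i = x i" if "\<bar>i\<bar> \<le> int m'" for i
    proof -
      have "nat (i + int m') < length (map x [- int m'..int m'])" using that by auto
      then have "y (- int m' + int (nat (i + int m'))) = map x [- int m'..int m'] ! nat (i + int m')"
        using y(3) unfolding occurs_at_def by blast
      then show ?thesis using that by (simp add: abs_le_iff)
    qed
    have "y i \<in> B i" for i
    proof (cases "B i = UNIV")
      case False
      then have "y i = x i" using m[OF False] y(2) by (intro eq) simp
      then show ?thesis using B(2) by (auto simp: PiE_iff)
    qed simp
    then show ?thesis using B(3) V(2) y(1) by (auto simp: PiE_iff)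
  qed
  then show ?thesis using that by blast
qed

lemma prod_Sigma_space_nbhd:
  assumes "openin (prod_topology Sigma_space Sigma_space) T" "T \<noteq> {}"
  obtains m w u where "w \<in> zeta_language" "u \<in> zeta_language"
    "\<And>x y. x \<in> Sigma_set \<Longrightarrow> y \<in> Sigma_set \<Longrightarrow> occurs_at x m w \<Longrightarrow> occurs_at y m u \<Longrightarrow> (x, y) \<in> T"
proof -
  obtain x0 y0 where xy: "(x0, y0) \<in> T" using assms(2) by auto
  then obtain U V where UV: "openin Sigma_space U" "openin Sigma_space V"
    "x0 \<in> U" "y0 \<in> V" "U \<times> V \<subseteq> T"
    using assms(1) unfolding openin_prod_topology_alt by meson
  then have S: "x0 \<in> Sigma_set" "y0 \<in> Sigma_set"
    using openin_subset[of Sigma_space] by auto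
  obtain m where m: "\<And>y m'. y \<in> Sigma_set \<Longrightarrow> m \<le> m' \<Longrightarrow>
    occurs_at y (- int m') (map x0 [- int m'..int m']) \<Longrightarrow> y \<in> U"
    using Sigma_space_nbhd[OF UV(1,3)] by metis
  obtain n where n: "\<And>y m'. y \<in> Sigma_set \<Longrightarrow> n \<le> m' \<Longrightarrow>
    occurs_at y (- int m') (map y0 [- int m'..int m']) \<Longrightarrow> y \<in> V"
    using Sigma_space_nbhd[OF UV(2,4)] by metis
  let ?M = "int (max m n)"
  show ?thesis
  proof (rule that[of "map x0 [- ?M..?M]" "map y0 [- ?M..?M]" "- ?M"])
    show "map x0 [- ?M..?M] \<in> zeta_language" "map y0 [- ?M..?M] \<in> zeta_language"
      using S by (auto simp: Sigma_set_def)
    show "(x, y) \<in> T" if "x \<in> Sigma_set" "y \<in> Sigma_set"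
      "occurs_at x (- ?M) (map x0 [- ?M..?M])" "occurs_at y (- ?M) (map y0 [- ?M..?M])" for x y
      using m[of x "max m n"] n[of y "max m n"] that UV(5) by auto
  qed
qed

section \<open>Dense orbits by Baire category\<close>

lemma countable_zeta_language: "countable zeta_language"
proof -
  have "zeta_language = (\<Union>t. set (sublists (core t)))"
    by (auto simp: mem_zeta_language_iff)
  moreover have "countable \<dots>" by (intro countable_UN) (auto intro: countable_finite)
  ultimately show ?thesis by simp
qed

text \<open>A single \<open>n\<close> serves both coordinates: a point in these sets for all words
  of the language has a dense orbit under the product map.\<close>

definition joint_visits :: "letter list \<Rightarrow> letter list \<Rightarrow> ((int \<Rightarrow> letter) \<times> (int \<Rightarrow> letter)) set" where
  "joint_visits w u = {(x, y). x \<in> Sigma_set \<and> y \<in> Sigma_set \<and> (\<exists>n. occurs_at x n w \<and> occurs_at y n u)}"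

lemma openin_joint_visits: "openin (prod_topology Sigma_space Sigma_space) (joint_visits w u)"
proof -
  have "joint_visits w u =
      (\<Union>n. {x \<in> Sigma_set. occurs_at x n w} \<times> {y \<in> Sigma_set. occurs_at y n u})"
    by (auto simp: joint_visits_def)
  then show ?thesis
    by (auto intro!: openin_Union simp: openin_prod_Times_iff openin_occurs_at)
qed

lemma dense_joint_visits:
  assumes "w \<in> zeta_language" "u \<in> zeta_language"
  shows "prod_topology Sigma_space Sigma_space closure_of joint_visits w u
    = topspace (prod_topology Sigma_space Sigma_space)"
  unfolding dense_intersects_open
proof (intro allI impI)
  fix T assume T: "openin (prod_topology Sigma_space Sigma_space) T \<and> T \<noteq> {}"
  obtain m w' u' where L: "w' \<in> zeta_language" "u' \<in> zeta_language"
    and sub: "\<And>x y. x \<in> Sigma_set \<Longrightarrow> y \<in> Sigma_set \<Longrightarrow>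
      occurs_at x m w' \<Longrightarrow> occurs_at y m u' \<Longrightarrow> (x, y) \<in> T"
    using prod_Sigma_space_nbhd T by metis
  obtain v v' p q p' q' where v: "v \<in> zeta_language" "v' \<in> zeta_language"
    "p \<in> occ w' v" "q \<in> occ w v" "p' \<in> occ u' v'" "q' \<in> occ u v'" "q - p = q' - p'"
    using zeta_language_product_transitive[OF L(1) assms(1) L(2) assms(2)] by metis
  \<comment> \<open>Placing \<open>v\<close> at \<open>m - p\<close> puts \<open>w'\<close> at
    \<open>m\<close> and \<open>w\<close> at \<open>m + (q - p)\<close>; placing \<open>v'\<close>
    at \<open>m - p'\<close> puts \<open>u'\<close> and \<open>u\<close> at the same two
    places.\<close>
  obtain x where x: "x \<in> Sigma_set" "occurs_at x (m - p) v"
    using exists_point[OF v(1)] by metis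
  obtain y where y: "y \<in> Sigma_set" "occurs_at y (m - p') v'"
    using exists_point[OF v(2)] by metis
  have "(x, y) \<in> T"
    using sub[OF x(1) y(1)] occurs_at_occ[OF x(2) v(3)] occurs_at_occ[OF y(2) v(5)] by simp
  moreover have "occurs_at x (m + (q - p)) w" "occurs_at y (m + (q - p)) u"
    using occurs_at_occ[OF x(2) v(4)] occurs_at_occ[OF y(2) v(6)] unfolding v(7)
    by (simp_all add: algebra_simps) (metis v(7) add_diff_eq diff_add_eq)
  then have "(x, y) \<in> joint_visits w u"
    using x y by (auto simp: joint_visits_def)
  ultimately show "joint_visits w u \<inter> T \<noteq> {}" by blast
qed

theorem theorem4p19:
  shows "topologically_weakly_mixing Sigma_space left_shift"
proof -
  let ?X = "prod_topology Sigma_space Sigma_space"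
  let ?G = "(\<lambda>(w, u). joint_visits w u) ` (zeta_language \<times> zeta_language)"
  have "compact_space Sigma_space" "Hausdorff_space Sigma_space"
    using Sigma_topological_dynamical_system metrizable_imp_Hausdorff_space
    by (auto simp: topological_dynamical_system_def)
  then have cH: "compact_space ?X" "Hausdorff_space ?X"
    by (auto simp: compact_space_prod_topology Hausdorff_space_prod_topology)
  have "?X closure_of \<Inter>?G = topspace ?X"
  proof (rule Baire_category)
    show "completely_metrizable_space ?X \<or> locally_compact_space ?X \<and> regular_space ?X"
      using cH compact_imp_locally_compact_space compact_Hausdorff_imp_regular_space by blast
    show "countable ?G" by (simp add: countable_zeta_language)
    show "openin ?X T \<and> ?X closure_of T = topspace ?X" if "T \<in> ?G" for T
      using that openin_joint_visits dense_joint_visits by auto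
  qed
  moreover obtain x0 where "x0 \<in> Sigma_set" using exists_point_core by blast
  then have "topspace ?X \<noteq> {}" by auto
  ultimately have "\<Inter>?G \<noteq> {}" by (metis closure_of_empty)
  then obtain x y where "(x, y) \<in> \<Inter>?G" by (metis ex_in_conv surj_pair)
  then have visits: "(x, y) \<in> joint_visits w u" if "w \<in> zeta_language" "u \<in> zeta_language" for w u
    using that by blast
  obtain t where "core t \<in> zeta_language" by (auto simp: mem_zeta_language_iff)
  then have S: "x \<in> Sigma_set" "y \<in> Sigma_set"
    using visits by (auto simp: joint_visits_def)
  let ?O = "orbit ?X (map_prod left_shift left_shift) (x, y)"
  have "?X closure_of ?O = topspace ?X"
    unfolding dense_intersects_open
  proof (intro allI impI)
    fix T assume T: "openin ?X T \<and> T \<noteq> {}"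
    obtain m w u where L: "w \<in> zeta_language" "u \<in> zeta_language"
      and sub: "\<And>x y. x \<in> Sigma_set \<Longrightarrow> y \<in> Sigma_set \<Longrightarrow>
        occurs_at x m w \<Longrightarrow> occurs_at y m u \<Longrightarrow> (x, y) \<in> T"
      using prod_Sigma_space_nbhd T by metis
    obtain n where n: "occurs_at x n w" "occurs_at y n u"
      using visits[OF L] by (auto simp: joint_visits_def)
    \<comment> \<open>The shift by \<open>n - m\<close> moves the joint visit from \<open>n\<close>
      to the prescribed place \<open>m\<close>.\<close>
    have "((\<lambda>k. x (k + (n - m))), (\<lambda>k. y (k + (n - m)))) \<in> T"
      using n S by (intro sub shift_in_Sigma_set) (auto simp: occurs_at_def algebra_simps)
    moreover have "((\<lambda>k. x (k + (n - m))), (\<lambda>k. y (k + (n - m)))) \<in> ?O"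
      unfolding orbit_def int_iterate_left_shift_prod[OF S, symmetric] by blast
    ultimately show "?O \<inter> T \<noteq> {}" by blast
  qed
  then show ?thesis
    using S unfolding topologically_weakly_mixing_def topologically_ergodic_def
    by (intro bexI[of _ "(x, y)"]) auto
qed

end
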